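(* Let $(\Omega,\Sigma,\mu)$ be a $\sigma$-finite complete measure space, let $p:\Omega\to[1,\infty)$ be a measurable function (so $1\le p(x)<\infty$ for a.a. $x\in\Omega$), and let $\Phi(x,t)=t^{p(x)}/p(x)$ for a.a. $x\in\Omega$ and all $t\ge 0$. Put $p^+=\operatorname{ess\,sup}_{x\in\Omega}p(x)$ and $p^-=\operatorname{ess\,inf}_{x\in\Omega}p(x)$. Then $\Phi$ satisfies condition $\Delta_2$ if and only if $p^+<\infty$. Its complementary function $\Phi^*$ satisfies condition $\Delta_2$ if and only if $p^->1$.
   Context: For $\Phi:\Omega\times[0,\infty)\to[0,\infty]$, the complementary function is $\Phi^*(x,t)=\sup_{s\ge 0}\{st-\Phi(x,s)\}$ for a.a. $x\in\Omega$, $t\ge0$; it may take the value $+\infty$ even if $\Phi$ is finite. A function $\Phi:\Omega\times[0,\infty)\to[0,\infty]$ satisfies condition $\Delta_2$ if there exist a constant $K>0$ and a non-negative function $h\in L^1(\Omega)$ such that $\Phi(x,2t)\le K\Phi(x,t)+h(x)$ for a.a. $x\in\Omega$ and all $t\ge0$. *)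

theory Defs
  imports "HOL-Probability.Essential_Supremum"
begin

text \<open>
  A function \<open>\<Omega> \<times> [0,\<infinity>) \<rightarrow> [0,\<infinity>]\<close> is represented by a curried map into \<^typ>\<open>ereal\<close>;
  its values at a negative second argument are irrelevant. With \<^typ>\<open>ereal\<close> instead of
  \<^typ>\<open>ennreal\<close>, the difference in the complementary function is not truncated at \<open>0\<close>.
\<close>

definition complementary :: "('a \<Rightarrow> real \<Rightarrow> ereal) \<Rightarrow> 'a \<Rightarrow> real \<Rightarrow> ereal" where
  "complementary \<Phi> x t = (SUP s\<in>{0..}. ereal (s * t) - \<Phi> x s)"

definition Delta2 :: "'a measure \<Rightarrow> ('a \<Rightarrow> real \<Rightarrow> ereal) \<Rightarrow> bool" where
  "Delta2 M \<Phi> \<longleftrightarrow>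
     (\<exists>K > 0. \<exists>h :: 'a \<Rightarrow> real. integrable M h \<and> (\<forall>x\<in>space M. 0 \<le> h x) \<and>
        (AE x in M. \<forall>t\<ge>0. \<Phi> x (2 * t) \<le> ereal K * \<Phi> x t + ereal (h x)))"

definition essinf :: "'a measure \<Rightarrow> ('a \<Rightarrow> ereal) \<Rightarrow> ereal" where
  "essinf M f = Sup {c. AE x in M. c \<le> f x}"

end

theory Submission
  imports Defs
begin

text \<open>
  For a power function \<open>t powr q / q\<close> doubling the argument multiplies the value by exactly
  \<open>2 powr q\<close>. Since \<open>t powr q\<close> is unbounded in \<open>t\<close>, no additive term that is independent of \<open>t\<close> can
  compensate a factor \<open>K < 2 powr q\<close>; hence \<open>\<Delta>\<^sub>2\<close> for variable-exponent powers means precisely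
  that \<open>2 powr q x \<le> K\<close> almost everywhere, that is, that the exponent is essentially bounded
  (\<open>Delta2_power_iff\<close>). Applied to \<open>q = p\<close> this is the first equivalence.

  The second equivalence is the same statement applied to the complementary function. Where
  \<open>p x > 1\<close>, Young's inequality and its case of equality show that the complementary function is
  again a power, with the conjugate exponent \<open>p x / (p x - 1) = 1 + 1 / (p x - 1)\<close>
  (\<open>complementary_power\<close>), and a bound on it is the same as a lower bound on \<open>p\<close> above \<open>1\<close>.
  Where \<open>p x = 1\<close>, the complementary function jumps from \<open>0\<close> to \<open>\<infinity>\<close> at \<open>t = 1\<close>, which is
  incompatible with \<open>\<Delta>\<^sub>2\<close>; so either side of the second equivalence already forces \<open>p > 1\<close>
  almost everywhere.
\<close>

section \<open>Doubling for variable-exponent powers\<close>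

lemma powr_doubling_exponent_le:
  fixes K H q :: real
  assumes "K > 0" and "q > 0" and "H \<ge> 0"
    and doubling: "\<And>t. t \<ge> 0 \<Longrightarrow> (2 * t) powr q / q \<le> K * (t powr q / q) + H"
  shows "q \<le> log 2 K"
proof (rule ccontr)
  assume "\<not> q \<le> log 2 K"
  then have gap: "2 powr q - K > 0"
    using \<open>K > 0\<close> by (simp add: le_log_iff)
  \<comment> \<open>This \<open>t\<close> solves \<open>(2 powr q - K) * (t powr q / q) = H + 1\<close>.\<close>
  define t where "t = (q * (H + 1) / (2 powr q - K)) powr (1 / q)"
  have "t powr q = q * (H + 1) / (2 powr q - K)"
    using gap \<open>q > 0\<close> \<open>H \<ge> 0\<close> by (simp add: t_def powr_powr)
  then have "(2 powr q - K) * (t powr q / q) = H + 1"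
    using gap \<open>q > 0\<close> by simp
  moreover have "2 powr q * (t powr q / q) \<le> K * (t powr q / q) + H"
    using doubling[of t] by (simp add: t_def powr_mult)
  then have "(2 powr q - K) * (t powr q / q) \<le> H"
    unfolding left_diff_distrib by linarith
  ultimately show False
    by simp
qed

text \<open>
  Letting \<open>t\<close> tend to \<open>\<infinity>\<close> makes the additive term \<open>h x\<close> negligible, pointwise in \<open>x\<close>, which bounds
  \<open>q\<close> by \<open>log 2 K\<close>. Conversely, a bound \<open>L\<close> on \<open>q\<close> gives the factor \<open>K = 2 powr L\<close> with \<open>h = 0\<close>.
\<close>

lemma Delta2_power_iff:
  fixes q :: "'a \<Rightarrow> real" and \<Psi> :: "'a \<Rightarrow> real \<Rightarrow> ereal"
  assumes pos: "AE x in M. 0 < q x"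
    and power: "AE x in M. \<forall>t\<ge>0. \<Psi> x t = ereal (t powr q x / q x)"
  shows "Delta2 M \<Psi> \<longleftrightarrow> (\<exists>L. AE x in M. q x \<le> L)"
proof
  assume "Delta2 M \<Psi>"
  then obtain K h where "K > 0" and h: "\<forall>x\<in>space M. 0 \<le> h x"
    and doubling: "AE x in M. \<forall>t\<ge>0. \<Psi> x (2 * t) \<le> ereal K * \<Psi> x t + ereal (h x)"
    unfolding Delta2_def by blast
  have "AE x in M. q x \<le> log 2 K"
    using pos power doubling AE_space
  proof eventually_elim
    case (elim x)
    show ?case
    proof (rule powr_doubling_exponent_le[OF \<open>K > 0\<close>, where H = "h x"])
      fix t :: real
      assume "t \<ge> 0"
      then have "\<Psi> x (2 * t) \<le> ereal K * \<Psi> x t + ereal (h x)"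
        and "\<Psi> x (2 * t) = ereal ((2 * t) powr q x / q x)"
        and "\<Psi> x t = ereal (t powr q x / q x)"
        using elim by auto
      then show "(2 * t) powr q x / q x \<le> K * (t powr q x / q x) + h x"
        by simp
    qed (use elim h in auto)
  qed
  then show "\<exists>L. AE x in M. q x \<le> L" ..
next
  assume "\<exists>L. AE x in M. q x \<le> L"
  then obtain L where L: "AE x in M. q x \<le> L" ..
  have "AE x in M. \<forall>t\<ge>0. \<Psi> x (2 * t) \<le> ereal (2 powr L) * \<Psi> x t + ereal 0"
    using pos power L
  proof eventually_elim
    case (elim x)
    show ?case
    proof (intro allI impI)
      fix t :: real
      assume "t \<ge> 0"
      have "2 powr q x * (t powr q x / q x) \<le> 2 powr L * (t powr q x / q x)"
        using elim by (intro mult_right_mono) auto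
      then have "(2 * t) powr q x / q x \<le> 2 powr L * (t powr q x / q x)"
        by (simp add: powr_mult)
      moreover have "\<Psi> x (2 * t) = ereal ((2 * t) powr q x / q x)"
        and "\<Psi> x t = ereal (t powr q x / q x)"
        using elim \<open>t \<ge> 0\<close> by auto
      ultimately show "\<Psi> x (2 * t) \<le> ereal (2 powr L) * \<Psi> x t + ereal 0"
        by simp
    qed
  qed
  then show "Delta2 M \<Psi>"
    unfolding Delta2_def by (intro exI[of _ "2 powr L"] exI[of _ "\<lambda>_. 0"] conjI) auto
qed

section \<open>The complementary function of a power\<close>

text \<open>
  The supremum is attained at \<open>s = t powr (1 / (p - 1))\<close>, where the derivative \<open>t - s powr (p - 1)\<close>
  of the concave function \<open>s * t - s powr p / p\<close> vanishes; this is the case of equality in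
  Young's inequality, which gives the upper bound.
\<close>

lemma complementary_power:
  fixes p t :: real
  assumes "p > 1" and "t \<ge> 0"
    and power: "\<And>s. s \<ge> 0 \<Longrightarrow> \<Phi> x s = ereal (s powr p / p)"
  shows "complementary \<Phi> x t = ereal (t powr (p / (p - 1)) / (p / (p - 1)))"
proof -
  define q where "q = p / (p - 1)"
  have "q > 1" and conj: "1 / p + 1 / q = 1"
    using \<open>p > 1\<close> by (simp_all add: q_def field_simps)
  have "(SUP s\<in>{0..}. ereal (s * t) - \<Phi> x s) = ereal (t powr q / q)"
  proof (rule antisym)
    show "(SUP s\<in>{0..}. ereal (s * t) - \<Phi> x s) \<le> ereal (t powr q / q)"
    proof (rule SUP_least)
      fix s :: real
      assume "s \<in> {0..}"
      then have "s * t \<le> s powr p / p + t powr q / q"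
        using \<open>p > 1\<close> \<open>q > 1\<close> conj \<open>t \<ge> 0\<close> by (intro Youngs_inequality) auto
      then show "ereal (s * t) - \<Phi> x s \<le> ereal (t powr q / q)"
        using \<open>s \<in> {0..}\<close> by (simp add: power)
    qed
  next
    define s where "s = t powr (1 / (p - 1))"
    have "s * t = t powr (1 / (p - 1) + 1)"
      using \<open>t \<ge> 0\<close> by (cases "t = 0") (simp_all add: s_def powr_add)
    also have "1 / (p - 1) + 1 = q"
      using \<open>p > 1\<close> by (simp add: q_def field_simps)
    finally have "s * t = t powr q" .
    moreover have "s powr p = t powr q"
      by (simp add: s_def q_def powr_powr)
    moreover have "t powr q = t powr q / p + t powr q / q"
      using arg_cong[OF conj, of "\<lambda>c. t powr q * c"] by (simp add: distrib_left)
    ultimately have "ereal (t powr q / q) = ereal (s * t) - \<Phi> x s"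
      by (simp add: power s_def)
    also have "\<dots> \<le> (SUP s\<in>{0..}. ereal (s * t) - \<Phi> x s)"
      by (rule SUP_upper) (simp add: s_def)
    finally show "ereal (t powr q / q) \<le> (SUP s\<in>{0..}. ereal (s * t) - \<Phi> x s)" .
  qed
  then show ?thesis
    by (simp add: complementary_def q_def)
qed

text \<open>
  The complementary function of the identity is the convex indicator of \<open>[0, 1]\<close>; its values
  at \<open>1\<close> and at \<open>2\<close> suffice to contradict \<open>\<Delta>\<^sub>2\<close>.
\<close>

lemma complementary_identity:
  assumes identity: "\<And>s. s \<ge> 0 \<Longrightarrow> \<Phi> x s = ereal s"
  shows "complementary \<Phi> x 1 = 0" and "complementary \<Phi> x 2 = \<infinity>"
proof -
  have "complementary \<Phi> x 1 = (SUP s\<in>{0::real..}. (0::ereal))"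
    unfolding complementary_def by (rule SUP_cong) (auto simp: identity)
  then show "complementary \<Phi> x 1 = 0"
    by simp
  show "complementary \<Phi> x 2 = \<infinity>"
    unfolding complementary_def
  proof (rule SUP_PInfty)
    fix n :: nat
    show "\<exists>s\<in>{0..}. ereal (real n) \<le> ereal (s * 2) - \<Phi> x s"
      by (rule bexI[of _ "real n"]) (simp_all add: identity)
  qed
qed

lemma Delta2_complementary_imp_exponent_gt_1:
  fixes p :: "'a \<Rightarrow> real"
  assumes "Delta2 M (complementary \<Phi>)"
    and "AE x in M. 1 \<le> p x"
    and "AE x in M. \<forall>t\<ge>0. \<Phi> x t = ereal (t powr p x / p x)"
  shows "AE x in M. 1 < p x"
proof -
  obtain K h where doubling: "AE x in M. \<forall>t\<ge>0.
      complementary \<Phi> x (2 * t) \<le> ereal K * complementary \<Phi> x t + ereal (h x)"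
    using assms(1) unfolding Delta2_def by blast
  show ?thesis
    using doubling assms(2,3)
  proof eventually_elim
    case (elim x)
    have "p x \<noteq> 1"
    proof
      assume "p x = 1"
      then have "\<And>s. s \<ge> 0 \<Longrightarrow> \<Phi> x s = ereal s"
        using elim by simp
      note complementary_values = complementary_identity[of \<Phi> x, OF this]
      have "complementary \<Phi> x (2 * 1) \<le> ereal K * complementary \<Phi> x 1 + ereal (h x)"
        using elim by (meson zero_le_one)
      then show False
        by (simp add: complementary_values)
    qed
    then show ?case
      using elim by simp
  qed
qed

text \<open>
  The conjugate exponent \<open>1 + 1 / (p x - 1)\<close> decreases in \<open>p x\<close> and blows up as \<open>p x\<close> tends to \<open>1\<close>, so
  upper bounds for it correspond to lower bounds for \<open>p\<close> beyond \<open>1\<close>.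
\<close>

lemma Delta2_complementary_power_iff:
  fixes p :: "'a \<Rightarrow> real"
  assumes ge_1: "AE x in M. 1 \<le> p x"
    and power: "AE x in M. \<forall>t\<ge>0. \<Phi> x t = ereal (t powr p x / p x)"
  shows "Delta2 M (complementary \<Phi>) \<longleftrightarrow> (\<exists>c>1. AE x in M. c \<le> p x)"
proof -
  define q where "q x = p x / (p x - 1)" for x
  have conjugate: "Delta2 M (complementary \<Phi>) \<longleftrightarrow> (\<exists>L. AE x in M. q x \<le> L)"
    if gt_1: "AE x in M. 1 < p x"
  proof (rule Delta2_power_iff)
    show "AE x in M. 0 < q x"
      using gt_1 by eventually_elim (simp add: q_def)
    show "AE x in M. \<forall>t\<ge>0. complementary \<Phi> x t = ereal (t powr q x / q x)"
      using gt_1 power by eventually_elim (simp add: q_def complementary_power)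
  qed
  show ?thesis
  proof
    assume Delta2: "Delta2 M (complementary \<Phi>)"
    have gt_1: "AE x in M. 1 < p x"
      using Delta2 ge_1 power by (rule Delta2_complementary_imp_exponent_gt_1)
    then obtain L where L: "AE x in M. q x \<le> L"
      using Delta2 conjugate by blast
    \<comment> \<open>The maximum with \<open>1\<close> keeps the constant meaningful on a null space, where \<open>L\<close> is arbitrary.\<close>
    have "AE x in M. 1 + 1 / max 1 L \<le> p x"
      using gt_1 L
    proof eventually_elim
      case (elim x)
      have "q x = 1 + 1 / (p x - 1)"
        using elim by (simp add: q_def field_simps)
      then have "1 / (p x - 1) \<le> max 1 L"
        using elim by simp
      then show ?case
        using elim by (simp add: field_simps)
    qed
    then show "\<exists>c>1. AE x in M. c \<le> p x"
      by (intro exI[of _ "1 + 1 / max 1 L"]) simp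
  next
    assume "\<exists>c>1. AE x in M. c \<le> p x"
    then obtain c where "c > 1" and c: "AE x in M. c \<le> p x"
      by blast
    have gt_1: "AE x in M. 1 < p x"
      using c by eventually_elim (use \<open>c > 1\<close> in simp)
    have "AE x in M. q x \<le> 1 + 1 / (c - 1)"
      using c
    proof eventually_elim
      case (elim x)
      have "q x = 1 + 1 / (p x - 1)"
        using elim \<open>c > 1\<close> by (simp add: q_def field_simps)
      also have "1 / (p x - 1) \<le> 1 / (c - 1)"
        using elim \<open>c > 1\<close> by (intro divide_left_mono) auto
      finally show ?case
        by simp
    qed
    then show "Delta2 M (complementary \<Phi>)"
      using conjugate[OF gt_1] by blast
  qed
qed

section \<open>Essential bounds by real constants\<close>

lemma esssup_less_PInf_iff:
  fixes f :: "'a \<Rightarrow> real"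
  assumes "f \<in> borel_measurable M"
  shows "esssup M (\<lambda>x. ereal (f x)) < \<infinity> \<longleftrightarrow> (\<exists>L. AE x in M. f x \<le> L)"
proof
  assume "esssup M (\<lambda>x. ereal (f x)) < \<infinity>"
  then obtain L :: real where L: "esssup M (\<lambda>x. ereal (f x)) < ereal L"
    using ereal_dense2 by blast
  have "AE x in M. f x \<le> L"
    using esssup_AE[of "\<lambda>x. ereal (f x)" M]
  proof eventually_elim
    case (elim x)
    then have "ereal (f x) \<le> ereal L"
      using L by order
    then show ?case
      by simp
  qed
  then show "\<exists>L. AE x in M. f x \<le> L" ..
next
  assume "\<exists>L. AE x in M. f x \<le> L"
  then obtain L where "AE x in M. ereal (f x) \<le> ereal L"
    by auto
  then have "esssup M (\<lambda>x. ereal (f x)) \<le> ereal L"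
    using assms by (intro esssup_I) auto
  then show "esssup M (\<lambda>x. ereal (f x)) < \<infinity>"
    using le_less_trans by fastforce
qed

lemma less_essinf_iff:
  fixes f :: "'a \<Rightarrow> real"
  shows "ereal a < essinf M (\<lambda>x. ereal (f x)) \<longleftrightarrow> (\<exists>c>a. AE x in M. c \<le> f x)"
proof
  assume "ereal a < essinf M (\<lambda>x. ereal (f x))"
  then obtain d where "ereal a < d" and d: "AE x in M. d \<le> ereal (f x)"
    unfolding essinf_def less_Sup_iff by blast
  \<comment> \<open>On a null space \<open>d\<close> may be \<open>\<infinity>\<close>, so a real number below it is needed.\<close>
  obtain c :: real where "ereal a < ereal c" and "ereal c < d"
    using \<open>ereal a < d\<close> ereal_dense2 by blast
  have "AE x in M. c \<le> f x"
    using d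
  proof eventually_elim
    case (elim x)
    then have "ereal c \<le> ereal (f x)"
      using \<open>ereal c < d\<close> by order
    then show ?case
      by simp
  qed
  then show "\<exists>c>a. AE x in M. c \<le> f x"
    using \<open>ereal a < ereal c\<close> by auto
next
  assume "\<exists>c>a. AE x in M. c \<le> f x"
  then obtain c where "c > a" and "AE x in M. ereal c \<le> ereal (f x)"
    by auto
  then show "ereal a < essinf M (\<lambda>x. ereal (f x))"
    unfolding essinf_def less_Sup_iff by (intro bexI[of _ "ereal c"]) auto
qed

section \<open>Characterisation by the essential bounds of the exponent\<close>

theorem theorem1p7:
  fixes M :: "'a measure"
    and p :: "'a \<Rightarrow> real"
    and \<Phi> :: "'a \<Rightarrow> real \<Rightarrow> ereal"
  assumes "sigma_finite_measure M"
    and "complete_measure M"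
    and "p \<in> borel_measurable M"
    and "\<forall>x\<in>space M. 1 \<le> p x"
    and "\<forall>x\<in>space M. \<forall>t\<ge>0. 0 \<le> \<Phi> x t"
    and "AE x in M. \<forall>t\<ge>0. \<Phi> x t = ereal (t powr p x / p x)"
  shows "(Delta2 M \<Phi> \<longleftrightarrow> esssup M (\<lambda>x. ereal (p x)) < \<infinity>) \<and>
         (Delta2 M (complementary \<Phi>) \<longleftrightarrow> 1 < essinf M (\<lambda>x. ereal (p x)))"
proof
  have ge_1: "AE x in M. 1 \<le> p x"
    using assms(4) by (intro AE_I2) blast
  then have "AE x in M. 0 < p x"
    by eventually_elim simp
  then show "Delta2 M \<Phi> \<longleftrightarrow> esssup M (\<lambda>x. ereal (p x)) < \<infinity>"
    using Delta2_power_iff[OF _ assms(6)] esssup_less_PInf_iff[OF assms(3)] by blast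
  show "Delta2 M (complementary \<Phi>) \<longleftrightarrow> 1 < essinf M (\<lambda>x. ereal (p x))"
    using Delta2_complementary_power_iff[OF ge_1 assms(6)] less_essinf_iff[of 1 M p]
    by (simp add: one_ereal_def)
qed

end
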